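(* Let $p$ be an odd prime and $q=p^e$ with $e\ge 1$. Let $c_i\in\mathbb{F}_q$ ($1\le i\le q^2+q-1$) be the coefficients defined in the context. Then the following identities hold in $\mathbb{F}_q$: \begin{itemize} \item[(i)] $\displaystyle\sum_{a\in\mathbb{F}_q}E_j(1,a)=-c_j+\frac{j+1}{2^j}$ if $1\le j\le q-1$; \item[(ii)] $\displaystyle\sum_{a\in\mathbb{F}_q}E_q(1,a)=c_1-c_q+\frac{1}{2^q}$; \item[(iii)] $\displaystyle\sum_{a\in\mathbb{F}_q}E_{lq+j}(1,a)=\sum_{a\in\mathbb{F}_q}E_{(l-1)q+j}(1,a)-\sum_{a\in\mathbb{F}_q}E_{(l-1)q+j+1}(1,a)-c_{lq+j}-\frac{2^{q-1}j-j-1}{2^{lq+j}}$ if $1\le l\le q-2$ and $1\le j\le q-1$; \item[(iv)] $\displaystyle\sum_{a\in\mathbb{F}_q}E_{lq}(1,a)=\sum_{a\in\mathbb{F}_q}E_{(l-1)q}(1,a)-\sum_{a\in\mathbb{F}_q}E_{(l-1)q+1}(1,a)-c_{lq}+\frac{1}{2^{lq}}$ if $2\le l\le q-2$; \item[(v)] $\displaystyle\sum_{a\in\mathbb{F}_q}E_{q^2-q+j}(1,a)=\sum_{i=j}^{q-1}c_{q^2+i}+\frac{j+1}{2^{q^2-q+j}}$ if $0\le j\le q-1$. \end{itemize}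
   Context: $\mathbb{F}_q$ is the finite field with $q$ elements. For an integer $n\ge 0$, the reversed Dickson polynomial of the second kind (with parameter $1$) is $$E_n(1,x):=\sum_{i=0}^{\lfloor n/2\rfloor}\binom{n-i}{i}(-x)^i\in\mathbb{F}_q[x].$$ All integers and fractions with denominator a power of $2$ are interpreted in $\mathbb{F}_q$. The elements $b_i\in\mathbb{F}_q$ ($0\le i\le q^2-q$) are defined by the polynomial identity in $\mathbb{F}_q[t]$ $$\sum_{i=0}^{q^2-q}b_it^i=\frac{t^{q^2}-t}{t-t^q}=-1-(t-t^q)^{q-1}.$$ Explicitly, writing $i=\alpha+\beta q$ with $0\le\alpha,\beta\le q-1$: $b_i=(-1)^{\beta+1}\binom{q-1}{\beta}$ if $\alpha+\beta=q-1$; $b_i=-1$ if $\alpha=\beta=0$; and $b_i=0$ otherwise. The elements $c_i\in\mathbb{F}_q$ ($1\le i\le q^2+q-1$) are defined by the polynomial identity in $\mathbb{F}_q[t]$ $$\sum_{i=1}^{q^2+q-1}c_it^i=(1-t^q+t^{q-1})\sum_{i=1}^{q^2-1}t^i-\Big(t^{2(q-1)}+\sum_{k=1}^{q-1}(t-1)^{q-1-k}t^{2k}\Big(\frac14\Big)^k\Big)\Big(\sum_{i=0}^{q^2-q}b_it^i\Big).$$ *)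

theory Defs
  imports "HOL-Computational_Algebra.Computational_Algebra" "HOL-Library.Cardinality"
begin

abbreviation tvar :: "'a::comm_ring_1 poly" where
  "tvar \<equiv> [:0, 1:]"

text \<open>
  Reversed Dickson polynomial of the second kind \<open>E\<^sub>n(1,x)\<close>.
\<close>

definition rev_dickson2 :: "nat \<Rightarrow> 'a::comm_ring_1 poly" where
  "rev_dickson2 n = (\<Sum>i=0..n div 2. of_nat ((n - i) choose i) * (- tvar) ^ i)"

lemma poly_rev_dickson2:
  "poly (rev_dickson2 n) x = (\<Sum>i=0..n div 2. of_nat ((n - i) choose i) * (- x) ^ i)"
  by (simp add: rev_dickson2_def poly_sum)

text \<open>
  Over a field with \<open>q\<close> elements the division below is exact, see
  \<open>b_poly_times\<close>; \<open>b_poly_eq\<close> gives the closed form of the quotient.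
\<close>

definition b_poly :: "nat \<Rightarrow> 'a::field poly" where
  "b_poly q = (tvar ^ (q ^ 2) - tvar) div (tvar - tvar ^ q)"

definition b_coeff :: "nat \<Rightarrow> nat \<Rightarrow> 'a::field" where
  "b_coeff q i = coeff (b_poly q) i"

text \<open>
  Over a field with \<open>q\<close> elements, \<open>c_poly q\<close> has no constant term and degree at most
  \<open>q\<^sup>2 + q - 1\<close>, so that it equals the sum of the \<open>c\<^sub>i t\<^sup>i\<close> for \<open>1 \<le> i \<le> q\<^sup>2 + q - 1\<close>, see
  \<open>c_coeff_identity\<close>.
\<close>

definition c_poly :: "nat \<Rightarrow> 'a::field poly" where
  "c_poly q =
     (1 - tvar ^ q + tvar ^ (q - 1)) * (\<Sum>i=1..q^2 - 1. tvar ^ i)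
     - (tvar ^ (2 * (q - 1))
          + (\<Sum>k=1..q - 1. (tvar - 1) ^ (q - 1 - k) * tvar ^ (2 * k) * [:1 / 4:] ^ k))
       * (\<Sum>i=0..q^2 - q. monom (b_coeff q i) i)"

definition c_coeff :: "nat \<Rightarrow> nat \<Rightarrow> 'a::field" where
  "c_coeff q i = coeff (c_poly q) i"

lemma CHAR_eq_p:
  assumes "prime (p::nat)" and "CARD('a::finite_field) = p ^ e"
  shows "CHAR('a) = p"
proof -
  have "(\<Sum>a\<in>(UNIV::'a set). a) = (\<Sum>a\<in>(UNIV::'a set). a + 1)"
    by (rule sum.reindex_bij_witness[where i = "\<lambda>a. a + 1" and j = "\<lambda>a. a - 1"]) auto
  then have "of_nat (CARD('a)) = (0::'a)" by (simp add: sum.distrib)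
  then have "CHAR('a) dvd p ^ e"
    by (simp only: assms(2) of_nat_eq_0_iff_char_dvd)
  then have "CHAR('a) dvd p"
    using prime_dvd_power CHAR_prime by blast
  then show ?thesis using assms(1) CHAR_prime primes_dvd_imp_eq by blast
qed

lemma diff_power_q:
  fixes f g :: "'a::finite_field poly"
  assumes "prime p" and "CARD('a) = p ^ e"
  shows "(f - g) ^ (p ^ e) = f ^ (p ^ e) - g ^ (p ^ e)"
proof -
  have *: "CHAR('a poly) = p" using CHAR_eq_p[OF assms] by simp
  have add: "(f + g) ^ (p ^ e) = f ^ (p ^ e) + g ^ (p ^ e)" for f g :: "'a poly"
    by (rule freshmans_dream') (use * assms(1) in auto)
  from add[of "f - g" g] show ?thesis by (simp add: algebra_simps)
qed

lemma b_poly_times_aux: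
  fixes T :: "'a::finite_field poly"
  assumes "prime p" and "CARD('a) = p ^ e" and "q = p ^ e" and "q > 0"
  shows "(- 1 - (T - T ^ q) ^ (q - 1)) * (T - T ^ q) = T ^ (q ^ 2) - T"
proof -
  have "(T - T ^ q) ^ (q - 1) * (T - T ^ q) = (T - T ^ q) ^ q"
    using assms(4) by (metis power_minus_mult)
  also have "\<dots> = T ^ q - T ^ (q ^ 2)"
    using diff_power_q[OF assms(1,2), of T "T ^ q"] assms(3)
    by (simp add: power_mult [symmetric] power2_eq_square)
  finally show ?thesis by (simp add: algebra_simps)
qed

lemma degree_tvar_power: "degree (tvar ^ n :: 'a::field poly) = n"
  by (simp add: degree_power_eq)

context
  fixes p e q :: nat
  assumes p: "prime p" and e: "e \<ge> 1" and q: "q = p ^ e" and card: "CARD('a::finite_field) = q"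
begin

lemma q_gt_1: "q > 1"
  using p e q by (metis one_less_power prime_gt_1_nat zero_less_iff_neq_zero not_one_le_zero)

lemma tvar_diff_nonzero: "tvar - tvar ^ q \<noteq> (0::'a poly)"
proof
  assume "tvar - tvar ^ q = (0::'a poly)"
  then have "monom 1 1 = (monom 1 q :: 'a poly)"
    by (simp add: monom_altdef)
  then show False using q_gt_1 by (metis degree_monom_eq one_neq_zero less_irrefl)
qed

lemma b_poly_aux:
  "(- 1 - (tvar - tvar ^ q) ^ (q - 1)) * (tvar - tvar ^ q) = (tvar ^ (q ^ 2) - tvar :: 'a poly)"
proof -
  have "CARD('a) = p ^ e" "q > 0" using card q q_gt_1 by (simp_all only:)
  then show ?thesis by (rule b_poly_times_aux[OF p _ q])
qed

lemma b_poly_eq: "(b_poly q :: 'a poly) = - 1 - (tvar - tvar ^ q) ^ (q - 1)"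
proof -
  show ?thesis
    unfolding b_poly_def using tvar_diff_nonzero by (simp only: b_poly_aux[symmetric]) (rule nonzero_mult_div_cancel_right)
qed

lemma b_poly_times: "(b_poly q :: 'a poly) * (tvar - tvar ^ q) = tvar ^ (q ^ 2) - tvar"
  unfolding b_poly_eq by (rule b_poly_aux)

lemma degree_b_poly: "degree (b_poly q :: 'a poly) \<le> q ^ 2 - q"
proof -
  have "degree (tvar - tvar ^ q :: 'a poly) \<le> q"
    by (intro degree_diff_le) (use q_gt_1 in \<open>auto simp: degree_tvar_power\<close>)
  then have "degree ((tvar - tvar ^ q :: 'a poly) ^ (q - 1)) \<le> q * (q - 1)"
    using degree_power_le by (meson le_trans mult_le_mono1)
  moreover have "q * (q - 1) = q ^ 2 - q" by (simp add: power2_eq_square diff_mult_distrib2)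
  ultimately show ?thesis unfolding b_poly_eq by (intro degree_diff_le) auto
qed

lemma b_coeff_identity: "(\<Sum>i=0..q^2 - q. monom (b_coeff q i) i) = (b_poly q :: 'a poly)"
  unfolding b_coeff_def using poly_as_sum_of_monoms'[OF degree_b_poly] by (simp add: atMost_atLeast0)

lemma degree_c_poly: "degree (c_poly q :: 'a poly) \<le> q ^ 2 + q - 1"
proof -
  have qq: "q ^ 2 \<ge> q" using q_gt_1 by (simp add: power2_eq_square)
  have "degree ((1 - tvar ^ q + tvar ^ (q - 1)) * (\<Sum>i=1..q^2 - 1. tvar ^ i) :: 'a poly)
          \<le> q + (q ^ 2 - 1)"
    by (intro order.trans[OF degree_mult_le] add_mono degree_add_le degree_diff_le degree_sum_le)
       (auto simp: degree_tvar_power)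
  then have 1: "degree ((1 - tvar ^ q + tvar ^ (q - 1)) * (\<Sum>i=1..q^2 - 1. tvar ^ i) :: 'a poly)
          \<le> q ^ 2 + q - 1" using q_gt_1 by simp
  have k: "degree ((tvar - 1) ^ (q - 1 - k) * tvar ^ (2 * k) * [:1 / 4:] ^ k :: 'a poly)
          \<le> 2 * (q - 1)" if "k \<in> {1..q - 1}" for k
  proof -
    have "degree ((tvar - 1 :: 'a poly)) \<le> 1" by (rule degree_diff_le) auto
    then have "degree ((tvar - 1 :: 'a poly) ^ (q - 1 - k)) \<le> q - 1 - k"
      by (metis degree_power_le le_trans mult_1 mult_le_mono1)
    moreover have "degree ([:1 / 4:] ^ k :: 'a poly) \<le> 0"
      using degree_power_le[of "[:1/4:] :: 'a poly" k] by simp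
    ultimately have "degree ((tvar - 1) ^ (q - 1 - k) * tvar ^ (2 * k) * [:1 / 4:] ^ k :: 'a poly)
          \<le> (q - 1 - k) + 2 * k + 0"
      by (intro order.trans[OF degree_mult_le] add_mono) (simp_all only: degree_tvar_power order.refl)
    also have "(q - 1 - k) + 2 * k + 0 \<le> 2 * (q - 1)"
      using that unfolding atLeastAtMost_iff by linarith
    finally show ?thesis .
  qed
  have "degree ((tvar ^ (2 * (q - 1))
          + (\<Sum>k=1..q - 1. (tvar - 1) ^ (q - 1 - k) * tvar ^ (2 * k) * [:1 / 4:] ^ k))
       * b_poly q :: 'a poly) \<le> 2 * (q - 1) + (q ^ 2 - q)"
    by (intro order.trans[OF degree_mult_le] add_mono degree_b_poly degree_add_le degree_sum_le k)
       (simp_all only: degree_tvar_power order.refl finite_atLeastAtMost)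
  also have "\<dots> \<le> q ^ 2 + q - 1" using q_gt_1 qq by simp
  finally show ?thesis unfolding c_poly_def b_coeff_identity by (rule degree_diff_le[OF 1])
qed

lemma c_coeff_0: "c_coeff q 0 = (0::'a)"
  unfolding c_coeff_def poly_0_coeff_0[symmetric] c_poly_def using q_gt_1
  by (simp add: poly_sum zero_power)

lemma c_coeff_identity: "(\<Sum>i=1..q^2 + q - 1. monom (c_coeff q i) i) = (c_poly q :: 'a poly)"
proof -
  have "(\<Sum>i=1..q^2 + q - 1. monom (c_coeff q i) i) = (\<Sum>i=0..q^2 + q - 1. monom (c_coeff q i :: 'a) i)"
    by (simp add: sum.atLeast_Suc_atMost[of 0] c_coeff_0)
  also have "\<dots> = c_poly q"
    unfolding c_coeff_def using poly_as_sum_of_monoms'[OF degree_c_poly] by (simp add: atMost_atLeast0)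
  finally show ?thesis .
qed

end

end

theory Submission
  imports Defs
begin

text \<open>
  The generating function of \<open>E\<^sub>n(1,a)\<close> is \<open>1 / (1 - t + a t\<^sup>2)\<close>. Write
  \<open>f\<^sub>a = 1 - t + a t\<^sup>2\<close> and \<open>N = q\<^sup>2 - 1\<close>. For \<open>a \<noteq> 1/4\<close> the polynomial \<open>f\<^sub>a\<close> is
  separable of degree at most two, so its roots lie in the field with \<open>q\<^sup>2\<close> elements and
  \<open>f\<^sub>a\<close> divides \<open>1 - t\<^sup>N\<close>. Hence the values \<open>E\<^sub>n(1,a)\<close> have period \<open>N\<close>, and the
  truncation of the generating function to exponents below \<open>N\<close> is exactly
  \<open>(1 - t\<^sup>N) / f\<^sub>a\<close> (\<open>dickson_denom_inverse\<close>). The excluded value has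
  \<open>E\<^sub>n(1,1/4) = (n + 1) / 2\<^sup>n\<close> and accounts for all terms of the theorem that carry a
  power of \<open>2\<close> in the denominator.

  The functions \<open>1 / f\<^sub>a\<close> are then added up over \<open>a\<close>. They have a common denominator: since
  \<open>a\<^sup>q = a\<close>, the polynomial \<open>f\<^sub>a\<^sup>q - f\<^sub>a t\<^bsup>2(q-1)\<^esup>\<close> does not depend on \<open>a\<close>, and it equals
  \<open>D (1 - t\<^bsup>q-1\<^esup>)\<close> with \<open>D = 1 - t\<^sup>q + t\<^bsup>q-1\<^esup>\<close>. The numerators
  \<open>f\<^sub>a\<^bsup>q-1\<^esup> - t\<^bsup>2(q-1)\<^esup>\<close> are easy to add up: all power sums of exponent below \<open>q - 1\<close>
  vanish, so their sum over the whole field is \<open>- t\<^bsup>2(q-1)\<^esup>\<close>, and their sum over \<open>a \<noteq> 1/4\<close> is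
  \<open>- f\<^bsub>1/4\<^esub>\<^bsup>q-1\<^esup>\<close>. With \<open>s\<^sub>n\<close> for the sum of \<open>E\<^sub>n(1,a)\<close> over
  \<open>a \<noteq> 1/4\<close>, and \<open>b\<close> for the polynomial with coefficients \<open>b\<^sub>i\<close>, this gives
  \<open>D \<Sum>\<^bsub>n<N\<^esub> s\<^sub>n t\<^sup>n = b f\<^bsub>1/4\<^esub>\<^bsup>q-1\<^esup>\<close> (\<open>regular_sum_generating_function\<close>).

  On the other side, the sum over \<open>k\<close> in the definition of the \<open>c\<^sub>i\<close> is a geometric sum that
  collapses, in characteristic \<open>p\<close>, to \<open>f\<^bsub>1/4\<^esub>\<^bsup>q-1\<^esup> - (t - 1)\<^bsup>q-1\<^esup>\<close>. It follows that
  \<open>\<Sum> c\<^sub>i t\<^sup>i = - D \<Sum> s\<^sub>n t\<^sup>n\<close>, where \<open>n\<close> now runs from \<open>1\<close> to \<open>N\<close>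
  (\<open>c_poly_eq_regular_sum\<close>). Since \<open>D\<close> has three terms, comparing coefficients gives
  \<open>c\<^sub>n = - s\<^sub>n + s\<^bsub>n-q\<^esub> - s\<^bsub>n-q+1\<^esub>\<close>, where an index outside \<open>1, \<dots>, N\<close> contributes zero.
  All five claims are instances of this relation; in the last one it is telescoped from the
  top exponents downwards.
\<close>

section \<open>Values of the reversed Dickson polynomials\<close>

lemma poly_rev_dickson2_extended:
  assumes "n div 2 \<le> m"
  shows "poly (rev_dickson2 n) a = (\<Sum>i\<le>m. of_nat ((n - i) choose i) * (- a) ^ i)"
  unfolding poly_rev_dickson2 using assms
  by (intro sum.mono_neutral_left) (auto simp: binomial_eq_0)

lemma poly_rev_dickson2_0: "poly (rev_dickson2 0) a = 1"
  and poly_rev_dickson2_1: "poly (rev_dickson2 (Suc 0)) a = 1"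
  by (simp_all add: poly_rev_dickson2)

text \<open>Pascal's rule, summed against the powers of \<open>- a\<close>.\<close>

lemma poly_rev_dickson2_rec:
  "poly (rev_dickson2 (Suc (Suc n))) a
     = poly (rev_dickson2 (Suc n)) a - a * poly (rev_dickson2 n) a"
proof -
  have "poly (rev_dickson2 (Suc (Suc n))) a
          = (\<Sum>i\<le>Suc n. of_nat ((Suc (Suc n) - i) choose i) * (- a) ^ i)"
    by (rule poly_rev_dickson2_extended) simp
  also have "\<dots> = 1 + (\<Sum>i\<le>n. of_nat ((Suc n - i) choose Suc i) * (- a) ^ Suc i)"
    by (subst sum.atMost_Suc_shift) simp
  also have "(\<Sum>i\<le>n. of_nat ((Suc n - i) choose Suc i) * (- a) ^ Suc i)
      = (\<Sum>i\<le>n. of_nat ((n - i) choose Suc i) * (- a) ^ Suc i)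
        + (- a) * (\<Sum>i\<le>n. of_nat ((n - i) choose i) * (- a) ^ i)"
    unfolding sum_distrib_left sum.distrib[symmetric]
    by (rule sum.cong) (simp_all add: Suc_diff_le algebra_simps)
  also have "(\<Sum>i\<le>n. of_nat ((n - i) choose i) * (- a) ^ i) = poly (rev_dickson2 n) a"
    by (rule poly_rev_dickson2_extended[symmetric]) simp
  also have "1 + ((\<Sum>i\<le>n. of_nat ((n - i) choose Suc i) * (- a) ^ Suc i)
               + (- a) * poly (rev_dickson2 n) a)
      = (\<Sum>i\<le>Suc n. of_nat ((Suc n - i) choose i) * (- a) ^ i) - a * poly (rev_dickson2 n) a"
    by (subst sum.atMost_Suc_shift) simp
  also have "(\<Sum>i\<le>Suc n. of_nat ((Suc n - i) choose i) * (- a) ^ i) = poly (rev_dickson2 (Suc n)) a"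
    by (rule poly_rev_dickson2_extended[symmetric]) simp
  finally show ?thesis .
qed

text \<open>At \<open>1/4\<close> the characteristic polynomial \<open>X\<^sup>2 - X + 1/4\<close> of the recurrence has the double
  root \<open>1/2\<close>; this is what produces the exceptional terms of the theorem.\<close>

lemma poly_rev_dickson2_quarter:
  assumes "(2 :: 'a::field) \<noteq> 0"
  shows "poly (rev_dickson2 n) (1 / 4 :: 'a) = (of_nat n + 1) / 2 ^ n"
proof (induction n rule: induct_nat_012)
  case 0
  show ?case by (simp add: poly_rev_dickson2_0)
next
  case 1
  show ?case using assms by (simp add: poly_rev_dickson2_1)
next
  case (ge2 n)
  have combine: "(x + 1 + 1) / (b * z) - 1 / (b * b) * ((x + 1) / z) = (x + b + 1) / (b * (b * z))"
    if "b \<noteq> 0" "z \<noteq> 0" "b = 2" for x b z :: 'a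
    using that(1,2) by (simp add: field_simps) (simp add: that(3) algebra_simps)
  have "poly (rev_dickson2 (Suc (Suc n))) (1 / 4 :: 'a)
          = (of_nat n + 1 + 1) / (2 * 2 ^ n) - 1 / (2 * 2) * ((of_nat n + 1) / 2 ^ n)"
    unfolding poly_rev_dickson2_rec ge2 by (simp add: add_ac)
  also have "\<dots> = (of_nat n + 2 + 1) / (2 * (2 * 2 ^ n))" by (rule combine) (use assms in auto)
  finally show ?case by (simp add: add_ac)
qed

section \<open>Power sums over a finite field\<close>

lemma of_nat_CARD_eq_0: "of_nat CARD('a) = (0 :: 'a::{ring_1,finite})"
proof -
  have "(\<Sum>a\<in>(UNIV :: 'a set). a) = (\<Sum>a\<in>(UNIV :: 'a set). a + 1)"
    by (rule sum.reindex_bij_witness[where i = "\<lambda>a. a + 1" and j = "\<lambda>a. a - 1"]) auto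
  then show ?thesis by (simp add: sum.distrib)
qed

text \<open>A positive exponent whose power map is \<open>1\<close> on all nonzero elements is at least \<open>|F| - 1\<close>, so
  for \<open>0 < k < |F| - 1\<close> some \<open>b \<noteq> 0\<close> has \<open>b\<^sup>k \<noteq> 1\<close>; the substitution \<open>x \<mapsto> b x\<close>
  multiplies the sum by \<open>b\<^sup>k\<close>.\<close>

lemma sum_power_finite_field:
  assumes "k < CARD('a::finite_field) - 1"
  shows "(\<Sum>x\<in>(UNIV :: 'a set). x ^ k) = 0"
proof (cases "k = 0")
  case True
  then show ?thesis by (simp add: of_nat_CARD_eq_0)
next
  case False
  define P where "P = (monom 1 k - 1 :: 'a poly)"
  have P0: "P \<noteq> 0"
  proof
    assume "P = 0"
    then have "coeff P 0 = 0" by simp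
    with False show False by (simp add: P_def)
  qed
  have "degree P \<le> k" unfolding P_def by (intro degree_diff_le) (auto simp: degree_monom_le)
  then have "card {x. poly P x = 0} \<le> k" using card_poly_roots_bound[OF P0] by simp
  moreover have "CARD('a) - 1 = card (- {0 :: 'a})" by (simp add: card_Diff_singleton Compl_eq_Diff_UNIV)
  ultimately have "\<not> - {0} \<subseteq> {x. poly P x = 0}"
    using assms card_mono[of "{x. poly P x = 0}" "- {0}"] by fastforce
  then obtain b :: 'a where b: "b \<noteq> 0" "b ^ k \<noteq> 1" by (auto simp: P_def poly_monom)
  have "(\<Sum>x\<in>(UNIV :: 'a set). x ^ k) = (\<Sum>x\<in>UNIV. (b * x) ^ k)"
    by (rule sum.reindex_bij_witness[where i = "\<lambda>x. b * x" and j = "\<lambda>x. x / b"]) (use b in auto)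
  also have "\<dots> = b ^ k * (\<Sum>x\<in>UNIV. x ^ k)" by (simp add: power_mult_distrib sum_distrib_left)
  finally show ?thesis using b by (metis mult_cancel_right1)
qed

lemma power_card_minus_1:
  fixes x :: "'a::finite_field"
  assumes "x \<noteq> 0"
  shows "x ^ (CARD('a) - 1) = 1"
proof -
  have "x * x ^ (CARD('a) - 1) = x ^ CARD('a)"
    by (simp flip: power_Suc)
  then show ?thesis using assms by (simp add: finite_field_power_card_eq_same)
qed

lemma sum_power_card_minus_1: "(\<Sum>x\<in>(UNIV :: 'a::finite_field set). x ^ (CARD('a) - 1)) = - 1"
proof -
  have q: "CARD('a) > 1" using card_mono[of UNIV "{0, 1 :: 'a}"] by simp
  have "(\<Sum>x\<in>(UNIV :: 'a set). x ^ (CARD('a) - 1)) = (\<Sum>x\<in>(UNIV :: 'a set). 1 - (if x = 0 then 1 else 0))"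
    using q by (intro sum.cong) (auto simp: power_card_minus_1[unfolded One_nat_def])
  also have "\<dots> = of_nat CARD('a) - 1" by (simp add: sum_subtractf)
  finally show ?thesis by (simp add: of_nat_CARD_eq_0)
qed

text \<open>Of the binomial expansion only the top term survives, as all lower power sums vanish.\<close>

lemma sum_linear_power_card_minus_1:
  fixes X Y :: "'a::finite_field poly"
  shows "(\<Sum>a\<in>UNIV. (X + [:a:] * Y) ^ (CARD('a) - 1)) = - (Y ^ (CARD('a) - 1))"
proof -
  define n where "n = CARD('a) - 1"
  have "(\<Sum>a\<in>UNIV. (X + [:a:] * Y) ^ n)
      = (\<Sum>a\<in>UNIV. \<Sum>k\<le>n. of_nat (n choose k) * Y ^ k * X ^ (n - k) * [:a ^ k:])"
    by (subst add.commute, subst binomial_ring)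
       (simp only: power_mult_distrib poly_const_pow mult_ac)
  also have "\<dots> = (\<Sum>k\<le>n. of_nat (n choose k) * Y ^ k * X ^ (n - k) * [:\<Sum>a\<in>UNIV. a ^ k:])"
    by (subst sum.swap) (simp add: sum_distrib_left[symmetric] sum_to_poly del: mult_pCons_right)
  also have "\<dots> = (\<Sum>k\<le>n. if k = n then - (Y ^ n) else 0)"
    by (intro sum.cong) (auto simp: n_def sum_power_finite_field sum_power_card_minus_1[unfolded One_nat_def])
  finally show ?thesis by (simp add: n_def)
qed


section \<open>The polynomials \<open>1 - t + a t\<^sup>2\<close>\<close>

abbreviation dickson_denom :: "'a::comm_ring_1 \<Rightarrow> 'a poly" where
  "dickson_denom a \<equiv> [:1, - 1, a:]"

lemma dickson_denom_eq: "dickson_denom a = 1 - (tvar - [:a:] * tvar ^ 2)"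
  by (simp add: power2_eq_square one_pCons)

text \<open>Multiplying out a quotient by \<open>1 - t + a t\<^sup>2\<close> is the recurrence of the Dickson values.\<close>

lemma coeff_dickson_denom_mult:
  "coeff (dickson_denom a * h) 0 = coeff h 0"
  "coeff (dickson_denom a * h) (Suc 0) = coeff h (Suc 0) - coeff h 0"
  "coeff (dickson_denom a * h) (Suc (Suc n)) = coeff h (Suc (Suc n)) - coeff h (Suc n) + a * coeff h n"
  by (simp_all add: coeff_pCons)

lemma coeff_eq_rev_dickson2_if_quotient:
  assumes "dickson_denom a * h = 1 - monom 1 N" and "n < N"
  shows "coeff h n = poly (rev_dickson2 n) a"
  using assms(2)
proof (induction n rule: induct_nat_012)
  case 0
  show ?case using coeff_dickson_denom_mult(1)[of a h] 0 unfolding assms(1)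
    by (simp add: poly_rev_dickson2_0)
next
  case 1
  show ?case using coeff_dickson_denom_mult(2)[of a h] coeff_dickson_denom_mult(1)[of a h] 1 unfolding assms(1)
    by (simp add: poly_rev_dickson2_1)
next
  case (ge2 n)
  show ?case using coeff_dickson_denom_mult(3)[of a h n] ge2 unfolding assms(1)
    by (simp add: poly_rev_dickson2_rec algebra_simps)
qed

text \<open>The value \<open>1/4\<close> is left out because the discriminant \<open>1 - 4 a\<close> of \<open>f\<^sub>a\<close> vanishes
  there, so that the sequence of its values does not have period \<open>q\<^sup>2 - 1\<close>.\<close>

definition regular_sum :: "nat \<Rightarrow> 'a::finite_field" where
  "regular_sum n = (\<Sum>a\<in>UNIV - {1 / 4}. poly (rev_dickson2 n) a)"

text \<open>The index \<open>0\<close> is cut off, although \<open>s\<^sub>0 = - 1\<close>, and \<open>q\<^sup>2 - 1\<close> is kept: the polynomial with the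
  coefficients \<open>c\<^sub>i\<close> is divisible by \<open>t\<close>, so it corresponds to a full period that
  starts at \<open>1\<close>.\<close>

definition truncated_sum :: "nat \<Rightarrow> nat \<Rightarrow> 'a::finite_field" where
  "truncated_sum q n = (if 1 \<le> n \<and> n \<le> q ^ 2 - 1 then regular_sum n else 0)"

context
  fixes p e q :: nat
  assumes p: "prime p" and e: "e \<ge> 1" and q: "q = p ^ e" and card: "CARD('a::finite_field) = q"
begin

lemma q_greater_1: "q > 1"
  using q_gt_1[OF p e q card] .

lemma frobenius_diff: "(f - g) ^ q = f ^ q - (g :: 'a poly) ^ q"
  using diff_power_q[OF p, where 'a = 'a] card q by simp

lemma frobenius_const: "[:a:] ^ q = [:a :: 'a:]"
  using finite_field_power_card_eq_same[of a] by (simp add: poly_const_pow card)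

text \<open>
  This is the statement that the roots of \<open>f = f\<^sub>a\<close> lie in the field with \<open>q\<^sup>2\<close> elements,
  proved by computing modulo \<open>f\<close> instead of passing to an extension. With
  \<open>d = t\<^sup>q - t\<close> and \<open>w = a (t\<^sup>q + t) - 1\<close> one has \<open>f\<^sup>q - f = d w\<close>, so \<open>d w\<close> vanishes modulo
  \<open>f\<close>: either \<open>t\<^sup>q = t\<close>, or \<open>t\<^sup>q\<close> is the conjugate root. The polynomial
  \<open>X = t\<^bsup>q\<^sup>2\<^esup> - t\<close> satisfies \<open>X = d\<^sup>q + d\<close> and \<open>a X = w\<^sup>q - w\<close>, hence
  is killed by \<open>w\<close> and by \<open>a d\<close>, and therefore by \<open>w - a d = 2 a t - 1 = f'\<close>.
  The derivative is a unit modulo \<open>f\<close>, as its square is \<open>1 - 4 a\<close> modulo \<open>f\<close>.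
\<close>

lemma dickson_denom_dvd_field_equation:
  assumes a: "a \<noteq> (1 / 4 :: 'a)" and four: "(4 :: 'a) \<noteq> 0"
  shows "dickson_denom a dvd tvar ^ (q ^ 2) - tvar"
proof -
  define t where "t = (tvar :: 'a poly)"
  define c where "c = [:a:]"
  define f where "f = 1 - (t - c * t ^ 2)"
  define T where "T = t ^ q"
  define d where "d = T - t"
  define w where "w = c * T - (1 - c * t)"
  define X where "X = t ^ (q ^ 2) - t"
  have TT: "T ^ q = t ^ (q ^ 2)" by (simp only: T_def power2_eq_square power_mult)
  have cq: "c ^ q = c" unfolding c_def by (rule frobenius_const)
  have fq: "f ^ q = 1 - (T - c * T ^ 2)"
    unfolding f_def frobenius_diff power_mult_distrib cq T_def by (simp add: power_mult[symmetric] mult.commute)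
  have "f dvd f ^ q" using q_greater_1 by (intro dvd_power) auto
  moreover have "d * w = f ^ q - f" unfolding fq unfolding d_def w_def f_def
    by (simp add: algebra_simps power2_eq_square)
  ultimately have fdw: "f dvd d * w" by simp
  have X: "X = d ^ q + d" unfolding d_def frobenius_diff TT X_def by (simp add: T_def)
  have "d dvd X" unfolding X using q_greater_1 by (intro dvd_add dvd_power) auto
  then have fwX: "f dvd w * X" using fdw by (metis dvd_trans mult_dvd_mono dvd_refl mult.commute)
  have cX: "c * X = w ^ q - w"
    unfolding w_def frobenius_diff power_mult_distrib cq TT X_def by (simp add: T_def algebra_simps)
  have "w dvd c * X" unfolding cX using q_greater_1 by (intro dvd_diff dvd_power) auto
  then have fdX: "f dvd d * (c * X)" using fdw by (metis dvd_trans mult_dvd_mono dvd_refl)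
  have "(2 * c * t - 1) * X = w * X - d * (c * X)"
    unfolding w_def d_def by (simp add: algebra_simps)
  with fwX fdX have f2: "f dvd (2 * c * t - 1) * X" by simp
  have "(1 - 4 * c) * X = (2 * c * t - 1) * ((2 * c * t - 1) * X) - f * (4 * c * X)"
    unfolding f_def by (simp add: algebra_simps power2_eq_square)
  moreover have "f dvd \<dots>" by (rule dvd_diff[OF dvd_mult[OF f2] dvd_triv_left])
  ultimately have "f dvd (1 - 4 * c) * X" by simp
  also have "1 - 4 * c = [:1 - 4 * a:]" by (simp add: c_def one_pCons numeral_poly)
  finally have "f dvd smult (1 - 4 * a) X" by simp
  moreover have "1 - 4 * a \<noteq> 0" using a four by (auto simp: field_simps)
  ultimately have "f dvd X" by (simp add: dvd_smult_iff)
  then show ?thesis by (simp add: dickson_denom_eq f_def X_def c_def t_def)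
qed

text \<open>The degree bound on the quotient \<open>h\<close> makes its coefficients below \<open>q\<^sup>2 - 1\<close>, which are
  Dickson values by the recurrence, all of its coefficients. The vanishing of the next one
  closes the period.\<close>

lemma dickson_denom_inverse:
  assumes a: "a \<noteq> (1 / 4 :: 'a)" and four: "(4 :: 'a) \<noteq> 0"
  shows "dickson_denom a * (\<Sum>n<q^2 - 1. monom (poly (rev_dickson2 n) a) n) = 1 - monom 1 (q^2 - 1)"
    and "poly (rev_dickson2 (q^2 - 1)) a = 1"
proof -
  define f where "f = dickson_denom a"
  obtain N' where N': "q ^ 2 - 1 = Suc (Suc N')"
  proof -
    have "2 * 2 \<le> q * q" using q_greater_1 by (intro mult_le_mono) auto
    then have "q ^ 2 - 1 = Suc (Suc (q ^ 2 - 3))" by (simp add: power2_eq_square)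
    then show ?thesis using that by blast
  qed
  define N where "N = q ^ 2 - 1"
  define Y where "Y = 1 - (tvar :: 'a poly) ^ N"
  have "q ^ 2 = Suc N" using N' by (simp add: N_def)
  then have "tvar ^ (q ^ 2) - tvar = - (tvar * Y)"
    unfolding Y_def by (simp only:) (simp add: algebra_simps)
  then have "f dvd tvar * Y"
    using dickson_denom_dvd_field_equation[OF a four] unfolding f_def by (metis dvd_minus_iff)
  \<comment> \<open>Cancel the factor \<open>t\<close>, which is a unit modulo \<open>f\<close>: \<open>f + (1 - a t) t = 1\<close>.\<close>
  then have "f dvd f * Y + (1 - [:a:] * tvar) * (tvar * Y)"
    by (rule dvd_add[OF dvd_triv_left dvd_mult])
  also have "f * Y + (1 - [:a:] * tvar) * (tvar * Y) = Y"
    unfolding f_def dickson_denom_eq by (simp only: algebra_simps power2_eq_square) simp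
  finally obtain h where "Y = f * h" by blast
  moreover have "Y = 1 - monom 1 N" by (simp add: Y_def monom_altdef)
  ultimately have h: "f * h = 1 - monom 1 N" by simp
  have "coeff (1 - monom 1 N :: 'a poly) N = - 1" using N' by (simp add: N_def)
  then have Y0: "f * h \<noteq> 0" unfolding h by (metis coeff_0 neg_equal_0_iff_equal one_neq_zero)
  have "degree (f * h) \<le> N" unfolding h by (intro degree_diff_le) (auto simp: degree_monom_le)
  then have "degree f + degree h \<le> N" using Y0 degree_mult_eq by fastforce
  moreover have "degree f \<ge> 1" by (rule le_degree) (simp add: f_def)
  ultimately have deg: "degree h < N" by simp
  have co: "coeff h n = poly (rev_dickson2 n) a" if "n < N" for n
    using coeff_eq_rev_dickson2_if_quotient h that unfolding f_def by blast
  have "h = (\<Sum>n<N. monom (poly (rev_dickson2 n) a) n)"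
  proof (rule poly_eqI)
    fix n
    show "coeff h n = coeff (\<Sum>n<N. monom (poly (rev_dickson2 n) a) n) n"
      using co[of n] deg coeff_eq_0[of h n] by (cases "n < N") (auto simp: coeff_sum)
  qed
  then show "dickson_denom a * (\<Sum>n<q^2 - 1. monom (poly (rev_dickson2 n) a) n) = 1 - monom 1 (q^2 - 1)"
    using h by (simp add: f_def N_def)
  have "coeff h N = 0" using deg by (rule coeff_eq_0)
  moreover have "coeff (f * h) N = - 1" unfolding h using N' by (simp add: N_def)
  ultimately show "poly (rev_dickson2 (q^2 - 1)) a = 1"
    using coeff_dickson_denom_mult(3)[of a h N'] co[of N'] co[of "Suc N'"] N' 
    by (simp add: f_def N_def poly_rev_dickson2_rec algebra_simps)
qed

text \<open>The right-hand side is \<open>f\<^sub>a\<^sup>q - f\<^sub>a t\<^bsup>2(q-1)\<^esup>\<close>. Since \<open>a\<^sup>q = a\<close>, the Frobenius map turns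
  \<open>f\<^sub>a\<^sup>q\<close> into \<open>1 - t\<^sup>q + a t\<^bsup>2q\<^esup>\<close>, and the terms with \<open>a\<close> cancel. It is in fact the
  product of all \<open>f\<^sub>a\<close>.\<close>

lemma common_denominator_factorisation:
  "(1 - tvar ^ q + tvar ^ (q - 1)) * (1 - tvar ^ (q - 1))
     = dickson_denom a * (dickson_denom a ^ (q - 1) - (tvar ^ 2) ^ (q - 1) :: 'a poly)"
proof -
  define t where "t = (tvar :: 'a poly)"
  define c where "c = [:a:]"
  define f where "f = 1 - (t - c * t ^ 2)"
  define u where "u = t ^ (q - 1)"
  have tq: "t ^ q = t * u" unfolding u_def using q_greater_1 by (simp add: power_eq_if)
  have t2: "(t ^ 2) ^ q = (t * u) ^ 2" "(t ^ 2) ^ (q - 1) = u ^ 2"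
    unfolding tq[symmetric] by (simp_all only: u_def power_mult[symmetric] mult.commute)
  have "f * f ^ (q - 1) = f ^ q" using q_greater_1 by (simp add: power_eq_if)
  also have "\<dots> = 1 - (t * u - c * (t * u) ^ 2)"
    unfolding f_def frobenius_diff power_mult_distrib[of c] t2 tq
    using frobenius_const[of a] by (simp add: c_def)
  finally have "f * (f ^ (q - 1) - (t ^ 2) ^ (q - 1)) = (1 - t * u + u) * (1 - u)"
    unfolding right_diff_distrib t2 unfolding f_def by (simp add: algebra_simps power2_eq_square)
  then show ?thesis
    unfolding dickson_denom_eq unfolding t_def[symmetric] c_def[symmetric] tq
    unfolding u_def[symmetric] f_def[symmetric] by (rule sym)
qed

text \<open>Over the whole field the first power contributes \<open>- t\<^bsup>2(q-1)\<^esup>\<close> and the second, summed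
  \<open>q\<close> times, nothing; the summand at \<open>1/4\<close> is then taken out.\<close>

lemma sum_dickson_denom_power:
  "(\<Sum>a\<in>UNIV - {1 / 4}. dickson_denom a ^ (q - 1) - (tvar ^ 2) ^ (q - 1))
     = - (dickson_denom (1 / 4 :: 'a) ^ (q - 1))"
proof -
  have "(\<Sum>a\<in>(UNIV :: 'a set). dickson_denom a ^ (q - 1)) = - ((tvar ^ 2) ^ (q - 1))"
    using sum_linear_power_card_minus_1[of "1 - tvar :: 'a poly" "tvar ^ 2"]
    unfolding card dickson_denom_eq by (simp only: diff_diff_eq2 diff_add_eq)
  then have "(\<Sum>a\<in>UNIV. dickson_denom (a :: 'a) ^ (q - 1) - (tvar ^ 2) ^ (q - 1)) 
       = - ((tvar ^ 2) ^ (q - 1)) - of_nat CARD('a) * (tvar ^ 2) ^ (q - 1)"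
    by (simp only: sum_subtractf sum_constant)
  also have "of_nat CARD('a) = (0 :: 'a poly)"
    by (simp only: of_nat_poly of_nat_CARD_eq_0 pCons_0_0)
  finally have "(\<Sum>a\<in>UNIV. dickson_denom (a :: 'a) ^ (q - 1) - (tvar ^ 2) ^ (q - 1)) 
       = - ((tvar ^ 2) ^ (q - 1))" by simp
  then show ?thesis by (subst (asm) sum.remove[of _ "1 / 4"]) (simp_all add: algebra_simps add_eq_0_iff)
qed

lemma tvar_power_q2: "(tvar :: 'a poly) ^ (q ^ 2) = tvar * tvar ^ (q ^ 2 - 1)"
  using q_greater_1 by (simp add: power_eq_if)

lemma tvar_power_q: "(tvar :: 'a poly) ^ q = tvar * tvar ^ (q - 1)"
  using q_greater_1 by (simp add: power_eq_if)

lemma b_poly_times_geometric: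
  "(b_poly q :: 'a poly) * (1 - tvar ^ (q - 1)) = tvar ^ (q ^ 2 - 1) - 1"
proof -
  have "tvar * (b_poly q * (1 - tvar ^ (q - 1))) = (tvar * (tvar ^ (q ^ 2 - 1) - 1) :: 'a poly)"
    using b_poly_times[OF p e q card] unfolding tvar_power_q2 tvar_power_q by (simp only: algebra_simps mult_1_left mult_1_right)
  then show ?thesis by (simp only: mult_cancel_left) simp
qed

lemma one_minus_tvar_power_nonzero: "1 - tvar ^ (q - 1) \<noteq> (0 :: 'a poly)"
  using tvar_diff_nonzero[OF p e q card] unfolding tvar_power_q by (metis mult_zero_right right_diff_distrib mult_1_right)

text \<open>Multiplied by \<open>D (1 - t\<^bsup>q-1\<^esup>)\<close>, the identity \<open>f\<^sub>a P\<^sub>a = 1 - t\<^bsup>q\<^sup>2-1\<^esup>\<close> for the truncated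
  generating function \<open>P\<^sub>a\<close> turns into an equation without denominators that can be summed over
  \<open>a\<close>; the surplus factor \<open>1 - t\<^bsup>q-1\<^esup>\<close> cancels against \<open>1 - t\<^bsup>q\<^sup>2-1\<^esup>\<close>, leaving \<open>b\<close>.\<close>

lemma regular_sum_generating_function:
  assumes four: "(4 :: 'a) \<noteq> 0"
  shows "(1 - tvar ^ q + tvar ^ (q - 1)) * (\<Sum>n<q^2 - 1. monom (regular_sum n) n)
     = b_poly q * dickson_denom (1 / 4 :: 'a) ^ (q - 1)"
proof -
  define D where "D = (1 - tvar ^ q + tvar ^ (q - 1) :: 'a poly)"
  define v where "v = (1 - tvar ^ (q - 1) :: 'a poly)"
  define Q where "Q = (\<Sum>n<q^2 - 1. monom (regular_sum n :: 'a) n)"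
  define P where "P a = (\<Sum>n<q^2 - 1. monom (poly (rev_dickson2 n) a) n)" for a :: 'a
  have "Q = (\<Sum>a\<in>UNIV - {1 / 4}. P a)"
    unfolding Q_def P_def regular_sum_def monom_sum by (rule sum.swap)
  then have "D * v * Q = (\<Sum>a\<in>UNIV - {1 / 4}. D * v * P a)" by (simp add: sum_distrib_left)
  also have "\<dots> = (\<Sum>a\<in>UNIV - {1 / 4}. (dickson_denom a ^ (q - 1) - (tvar ^ 2) ^ (q - 1)) * (1 - tvar ^ (q ^ 2 - 1)))"
  proof (rule sum.cong[OF refl])
    fix a :: 'a assume "a \<in> UNIV - {1 / 4}"
    then have P: "dickson_denom a * P a = 1 - tvar ^ (q ^ 2 - 1)"
      using dickson_denom_inverse(1)[OF _ four, of a] by (simp add: P_def monom_altdef)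
    have "D * v * P a = (dickson_denom a ^ (q - 1) - (tvar ^ 2) ^ (q - 1)) * (dickson_denom a * P a)"
      unfolding D_def v_def common_denominator_factorisation[of a] by (simp only: mult_ac)
    then show "D * v * P a = (dickson_denom a ^ (q - 1) - (tvar ^ 2) ^ (q - 1)) * (1 - tvar ^ (q ^ 2 - 1))"
      unfolding P .
  qed
  also have "\<dots> = dickson_denom (1 / 4) ^ (q - 1) * (tvar ^ (q ^ 2 - 1) - 1)"
    unfolding sum_distrib_right[symmetric] sum_dickson_denom_power by (simp only: minus_mult_commute minus_diff_eq)
  also have "\<dots> = dickson_denom (1 / 4) ^ (q - 1) * (b_poly q * v)"
    unfolding v_def b_poly_times_geometric ..
  finally have "v * (D * Q) = v * (b_poly q * dickson_denom (1 / 4) ^ (q - 1))" by (simp only: mult_ac)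
  then show ?thesis using one_minus_tvar_power_nonzero unfolding D_def Q_def v_def
    by (simp only: mult_cancel_left simp_thms)
qed

section \<open>The coefficients \<open>c\<^sub>i\<close>\<close>

text \<open>With the summand for \<open>k = 0\<close> the left-hand side is \<open>(A\<^sup>q - B\<^sup>q) / (A - B)\<close>, and
  \<open>A\<^sup>q - B\<^sup>q = (A - B)\<^sup>q\<close>.\<close>

lemma sum_power_times_power:
  assumes "A \<noteq> (B :: 'a poly)"
  shows "(\<Sum>k=1..q - 1. A ^ (q - 1 - k) * B ^ k) = (A - B) ^ (q - 1) - A ^ (q - 1)"
proof -
  have "(A - B) * (\<Sum>k<q. A ^ (q - 1 - k) * B ^ k) = A ^ q - B ^ q"
    using power_diff_sumr2[of B q A] by (simp add: algebra_simps)
  also have "\<dots> = (A - B) * (A - B) ^ (q - 1)"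
    unfolding frobenius_diff[symmetric] using q_greater_1 by (simp add: power_eq_if)
  finally have *: "(\<Sum>k<q. A ^ (q - 1 - k) * B ^ k) = (A - B) ^ (q - 1)" using assms by simp
  have "{..<q} = {0..q - 1}" using q_greater_1 by auto
  then show ?thesis unfolding *[symmetric] by (simp add: sum.atLeast_Suc_atMost)
qed

text \<open>
  Put \<open>A = t - 1\<close>, \<open>B = t\<^sup>2/4\<close> and \<open>u = t\<^bsup>q-1\<^esup>\<close>. Then \<open>A - B = - f\<^bsub>1/4\<^esub>\<close>, so the sum over
  \<open>k\<close> is \<open>G - A\<^bsup>q-1\<^esup>\<close> with \<open>G = f\<^bsub>1/4\<^esub>\<^bsup>q-1\<^esup>\<close>; the exponent \<open>q - 1\<close> is even because
  \<open>q\<close> is odd. Multiplying by \<open>A\<close> turns \<open>A\<^bsup>q-1\<^esup>\<close> into \<open>A\<^sup>q = t\<^sup>q - 1\<close> and the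
  geometric sum of the powers of \<open>t\<close> into a multiple of \<open>b\<close>. What remains is
  \<open>b (D (1 - u) - G)\<close>, to which the generating function of the \<open>s\<^sub>n\<close> applies.
\<close>

lemma c_poly_eq_regular_sum:
  assumes four: "(4 :: 'a) \<noteq> 0" and odd: "odd q"
  shows "c_poly q = - ((1 - tvar ^ q + tvar ^ (q - 1))
            * (1 - monom 1 (q ^ 2 - 1) + (\<Sum>n<q^2 - 1. monom (regular_sum n :: 'a) n)))"
proof -
  define t where "t = (tvar :: 'a poly)"
  define u where "u = t ^ (q - 1)"
  define D where "D = 1 - t * u + u"
  define A where "A = t - 1"
  define B where "B = t ^ 2 * [:1 / 4:]"
  define b where "b = (b_poly q :: 'a poly)"
  define G where "G = dickson_denom (1 / 4 :: 'a) ^ (q - 1)"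
  define Z where "Z = (\<Sum>i=1..q^2 - 1. t ^ i)"
  define Q where "Q = (\<Sum>n<q^2 - 1. monom (regular_sum n :: 'a) n)"
  have tq: "t ^ q = t * u" unfolding t_def u_def by (rule tvar_power_q)
  have even: "even (q - 1)" using odd by simp
  have AB: "A - B = - dickson_denom (1 / 4)"
  proof -
    have "dickson_denom (1 / 4) = 1 - (t - B)"
      unfolding dickson_denom_eq t_def B_def by (simp only: mult.commute)
    then show ?thesis by (simp add: A_def)
  qed
  have "A \<noteq> B" using AB by auto
  then have K: "(\<Sum>k=1..q - 1. A ^ (q - 1 - k) * B ^ k) = G - A ^ (q - 1)"
    unfolding sum_power_times_power[OF \<open>A \<noteq> B\<close>] AB G_def using even by (simp only: power_minus_even)
  have bv: "b * (1 - u) = t ^ (q^2 - 1) - 1" unfolding b_def u_def t_def by (rule b_poly_times_geometric)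
  have AZ: "A * Z = t * (b * (1 - u))"
  proof -
    have "A * (\<Sum>i<q^2 - 1. t ^ i) = t ^ (q^2 - 1) - 1" unfolding A_def by (rule power_diff_1_eq[symmetric])
    moreover have "Z = t * (\<Sum>i<q^2 - 1. t ^ i)"
      unfolding Z_def sum_distrib_left using sum.atLeast1_atMost_eq[of "\<lambda>i. t ^ i"] by simp
    ultimately show ?thesis by (simp add: bv mult.left_commute[of A])
  qed
  have "A * A ^ (q - 1) = A ^ q" using q_greater_1 by (simp add: power_eq_if)
  also have "\<dots> = t * u - 1" unfolding A_def frobenius_diff tq by simp
  finally have Aq: "A * A ^ (q - 1) = t * u - 1" .
  have "c_poly q = (1 - t ^ q + t ^ (q - 1)) * Z - (t ^ (2 * (q - 1)) + (\<Sum>k=1..q - 1. A ^ (q - 1 - k) * B ^ k)) * b"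
    unfolding c_poly_def b_coeff_identity[OF p e q card] Z_def A_def B_def b_def t_def
    by (simp only: power_mult_distrib power_mult[symmetric] mult.assoc)
  also have "t ^ (2 * (q - 1)) = u * u" unfolding u_def by (simp add: power_add[symmetric] mult_2)
  finally have "c_poly q = D * Z - (u * u + (G - A ^ (q - 1))) * b"
    unfolding K tq D_def u_def[symmetric] .
  then have "A * c_poly q = D * (A * Z) - (A * (u * u) + A * G - A * A ^ (q - 1)) * b"
    by (simp only:) (simp add: algebra_simps)
  also have "\<dots> = A * (D * (b * (1 - u)) - b * G)"
    unfolding AZ Aq unfolding D_def A_def by (simp add: algebra_simps)
  finally have "A * c_poly q = A * (D * (b * (1 - u)) - b * G)" .
  moreover have "A \<noteq> 0" unfolding A_def t_def by (simp add: one_pCons)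
  ultimately have "c_poly q = D * (b * (1 - u)) - b * G" by simp
  also have "b * G = D * Q"
    unfolding D_def Q_def G_def b_def tq[symmetric] unfolding u_def t_def
    by (rule regular_sum_generating_function[OF four, symmetric])
  also have "D * (b * (1 - u)) - D * Q = - (D * (1 - t ^ (q^2 - 1) + Q))"
    unfolding bv by (simp add: algebra_simps)
  finally show ?thesis
    unfolding D_def tq[symmetric] unfolding u_def Q_def t_def by (simp add: monom_altdef)
qed

text \<open>The two stray terms \<open>1\<close> and \<open>- t\<^bsup>q\<^sup>2-1\<^esup>\<close> next to the generating function shift the period:
  as \<open>s\<^sub>0 = s\<^bsub>q\<^sup>2-1\<^esub> = - 1\<close>, the first removes the summand with index \<open>0\<close> and the second
  supplies the one with index \<open>q\<^sup>2 - 1\<close>.\<close>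

lemma c_coeff_eq_regular_sum:
  assumes four: "(4 :: 'a) \<noteq> 0" and odd: "odd q"
  shows "c_coeff q n = - (truncated_sum q n :: 'a) + (if n < q then 0 else truncated_sum q (n - q))
           - (if n < q - 1 then 0 else truncated_sum q (n - (q - 1)))"
proof -
  have N: "0 < q ^ 2 - 1" using one_less_power[OF q_greater_1, of 2] by simp
  have cardm: "of_nat (card (UNIV - {1 / 4 :: 'a})) = (- 1 :: 'a)"
    using of_nat_CARD_eq_0[where 'a = 'a] q_greater_1 card by (simp add: card_Diff_singleton of_nat_diff)
  have s0: "regular_sum 0 = (- 1 :: 'a)"
    unfolding regular_sum_def poly_rev_dickson2_0 using cardm by simp
  have "regular_sum (q ^ 2 - 1) = (\<Sum>a\<in>UNIV - {1 / 4 :: 'a}. 1 :: 'a)"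
    unfolding regular_sum_def using dickson_denom_inverse(2)[OF _ four] by (intro sum.cong) auto
  then have sN: "regular_sum (q ^ 2 - 1) = (- 1 :: 'a)" using cardm by simp
  define R where "R = 1 - monom 1 (q ^ 2 - 1) + (\<Sum>n<q^2 - 1. monom (regular_sum n :: 'a) n)"
  have R: "coeff R n = truncated_sum q n" for n
    using N s0 sN unfolding R_def truncated_sum_def by (cases "n = 0") (auto simp: coeff_sum)
  have "c_poly q = - R + monom 1 q * R - monom 1 (q - 1) * R"
    unfolding c_poly_eq_regular_sum[OF assms] R_def[symmetric] by (simp add: monom_altdef algebra_simps)
  then show ?thesis unfolding c_coeff_def by (simp add: coeff_monom_mult R)
qed

end



theorem theorem4p1:
  fixes p e q :: nat
  assumes "prime p" and "odd p" and "e \<ge> 1" and "q = p ^ e"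
    and "CARD('a::finite_field) = q"
  shows
    "(\<forall>j. 1 \<le> j \<and> j \<le> q - 1 \<longrightarrow>
        (\<Sum>a\<in>(UNIV::'a set). poly (rev_dickson2 j) a) = - c_coeff q j + (of_nat j + 1) / 2 ^ j) \<and>
     (\<Sum>a\<in>(UNIV::'a set). poly (rev_dickson2 q) a) = c_coeff q 1 - c_coeff q q + 1 / 2 ^ q \<and>
     (\<forall>l j. 1 \<le> l \<and> l \<le> q - 2 \<and> 1 \<le> j \<and> j \<le> q - 1 \<longrightarrow>
        (\<Sum>a\<in>(UNIV::'a set). poly (rev_dickson2 (l * q + j)) a)
          = (\<Sum>a\<in>(UNIV::'a set). poly (rev_dickson2 ((l - 1) * q + j)) a)
            - (\<Sum>a\<in>(UNIV::'a set). poly (rev_dickson2 ((l - 1) * q + j + 1)) a)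
            - c_coeff q (l * q + j)
            - (2 ^ (q - 1) * of_nat j - of_nat j - 1) / 2 ^ (l * q + j)) \<and>
     (\<forall>l. 2 \<le> l \<and> l \<le> q - 2 \<longrightarrow>
        (\<Sum>a\<in>(UNIV::'a set). poly (rev_dickson2 (l * q)) a)
          = (\<Sum>a\<in>(UNIV::'a set). poly (rev_dickson2 ((l - 1) * q)) a)
            - (\<Sum>a\<in>(UNIV::'a set). poly (rev_dickson2 ((l - 1) * q + 1)) a)
            - c_coeff q (l * q) + 1 / 2 ^ (l * q)) \<and>
     (\<forall>j. 0 \<le> j \<and> j \<le> q - 1 \<longrightarrow>
        (\<Sum>a\<in>(UNIV::'a set). poly (rev_dickson2 (q ^ 2 - q + j)) a)
          = (\<Sum>i=j..q - 1. c_coeff q (q ^ 2 + i)) + (of_nat j + 1) / 2 ^ (q ^ 2 - q + j))"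
proof -
  define S where "S n = (\<Sum>a\<in>(UNIV::'a set). poly (rev_dickson2 n) a)" for n
  define s where "s = (regular_sum :: nat \<Rightarrow> 'a)"
  note field_facts = assms(1,3,4,5)
  have q1: "q > 1" using q_greater_1[OF field_facts] .
  have odd: "odd q" using assms(2,4) by simp
  have two: "(2 :: 'a) \<noteq> 0"
  proof
    assume "(2 :: 'a) = 0"
    then have "of_nat 2 = (0 :: 'a)" by simp
    then have "CHAR('a) dvd 2" by (simp only: of_nat_eq_0_iff_char_dvd)
    moreover have "CHAR('a) = p" using CHAR_eq_p[OF assms(1)] assms(4,5) by metis
    ultimately have "p = 2" using assms(1) primes_dvd_imp_eq two_is_prime_nat by blast
    then show False using assms(2) by simp
  qed
  have "(4 :: 'a) = 2 * 2" by simp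
  then have four: "(4 :: 'a) \<noteq> 0" using two by (metis mult_eq_0_iff)
  have S: "S n = s n + (of_nat n + 1) / 2 ^ n" for n
    unfolding S_def s_def regular_sum_def poly_rev_dickson2_quarter[OF two, symmetric]
    by (simp add: sum.remove[of UNIV "1 / 4"])
  note c = c_coeff_eq_regular_sum[OF field_facts four odd] truncated_sum_def[where 'a = 'a, folded s_def]
  have q0: "of_nat q = (0 :: 'a)" using of_nat_CARD_eq_0[where 'a = 'a] assms(5) by simp
  have qq: "q ^ 2 = (q - 1) * q + q" "(q - 1) * q = (q - 2) * q + q"
    using q1 by (simp_all add: power2_eq_square algebra_simps Suc_diff_Suc)

  have i: "S j = - c_coeff q j + (of_nat j + 1) / 2 ^ j" if "1 \<le> j" "j \<le> q - 1" for j
    using that q1 qq unfolding S c by auto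
  have ii: "S q = c_coeff q 1 - c_coeff q q + 1 / 2 ^ q"
    using q1 qq unfolding S c q0 by auto
  \<comment> \<open>The last condition excludes \<open>l = 1\<close>, \<open>j = 0\<close>, where the index \<open>0\<close> is cut off; this is why
    \<open>E\<^sub>q\<close> has a separate formula.\<close>
  have step: "s (l * q + j) = s ((l - 1) * q + j) - s ((l - 1) * q + j + 1) - c_coeff q (l * q + j)"
    if lj: "1 \<le> l" "l \<le> q - 2" "j \<le> q - 1" "1 \<le> (l - 1) * q + j" for l j
  proof -
    obtain k where l: "l = Suc k" using lj by (cases l) auto
    have "l * q \<le> (q - 2) * q" using lj by (intro mult_le_mono1)
    then have "l * q + j \<le> q ^ 2 - 1" using lj q1 qq by linarith
    then show ?thesis using lj q1 unfolding c l by (auto simp: Suc_diff_le)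
  qed
  have "(2 :: 'a) ^ (q - 1) = 1" using power_card_minus_1[OF two] assms(5) by simp
  then have two_q: "2 ^ q = (2 :: 'a)" using q1 by (simp add: power_eq_if)
  \<comment> \<open>The contributions of \<open>1/4\<close>: as \<open>2\<^sup>q = 2\<close> and \<open>q = 0\<close> in the field,
    \<open>(m+1)/2\<^bsup>m+1\<^esup> = (m+1)/2\<^sup>m - (m+2)/2\<^bsup>m+1\<^esup> + 1/2\<^bsup>m+1\<^esup>\<close>.\<close>
  have step_S: "S (m + q) = S m - S (m + 1) - c_coeff q (m + q) + 1 / 2 ^ (m + q)"
    if "s (m + q) = s m - s (m + 1) - c_coeff q (m + q)" for m
    unfolding S that using two
    by (simp add: q0 power_add two_q field_simps)
  have iii: "S (l * q + j) = S ((l - 1) * q + j) - S ((l - 1) * q + j + 1) - c_coeff q (l * q + j)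
               - (2 ^ (q - 1) * of_nat j - of_nat j - 1) / 2 ^ (l * q + j)"
    if "1 \<le> l" "l \<le> q - 2" "1 \<le> j" "j \<le> q - 1" for l j
  proof -
    have eq: "(l - 1) * q + j + q = l * q + j" using that(1) by (cases l) auto
    show ?thesis using step_S[of "(l - 1) * q + j"] step[of l j] that \<open>2 ^ (q - 1) = 1\<close>
      unfolding eq by simp
  qed
  have iv: "S (l * q) = S ((l - 1) * q) - S ((l - 1) * q + 1) - c_coeff q (l * q) + 1 / 2 ^ (l * q)"
    if "2 \<le> l" "l \<le> q - 2" for l
  proof -
    have "l * q = (l - 1) * q + q" using that(1) by (cases l) auto
    moreover have "1 * 1 \<le> (l - 1) * q" using that(1) q1 by (intro mult_le_mono) auto
    ultimately show ?thesis using step_S[of "(l - 1) * q"] step[of l 0] that q1 by simp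
  qed
  have v: "S (q ^ 2 - q + j) = (\<Sum>i=j..q - 1. c_coeff q (q ^ 2 + i)) + (of_nat j + 1) / 2 ^ (q ^ 2 - q + j)"
    if j: "j \<le> q - 1" for j
  proof -
    \<comment> \<open>Above \<open>q\<^sup>2 - 1\<close> the term \<open>s\<^sub>n\<close> is cut off and each \<open>c\<^sub>n\<close> is a difference of neighbours.\<close>
    define g where "g i = (truncated_sum q (q ^ 2 - q + i) :: 'a)" for i
    have "(q - 1) * q \<ge> 1 * 1" using q1 by (intro mult_le_mono) auto
    then have ge: "q ^ 2 - q \<ge> 1" "q ^ 2 \<ge> q" "q ^ 2 - q + q = q ^ 2" unfolding qq(1) by auto
    have "c_coeff q (q ^ 2 + i) = - (g (Suc i) - g i)" for i
    proof -
      have "q ^ 2 + i - q = q ^ 2 - q + i" "q ^ 2 + i - (q - 1) = q ^ 2 - q + Suc i"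
        using ge q1 by auto
      moreover have "\<not> q ^ 2 + i \<le> q ^ 2 - 1" using ge(2) q1 by linarith
      then have "truncated_sum q (q ^ 2 + i) = (0 :: 'a)" by (simp only: c(2) simp_thms if_False)
      moreover have "\<not> q ^ 2 + i < q" "\<not> q ^ 2 + i < q - 1" using ge(2) q1 by linarith+
      ultimately show ?thesis unfolding c(1) g_def by simp
    qed
    then have "(\<Sum>i=j..q - 1. c_coeff q (q ^ 2 + i)) = - (\<Sum>i=j..q - 1. g (Suc i) - g i)"
      by (simp only: sum_negf)
    also have "\<dots> = - (g (Suc (q - 1)) - g j)" by (subst sum_Suc_diff) (use j in auto)
    also have "g (Suc (q - 1)) = 0" unfolding g_def using ge q1 by (simp add: c(2))
    also have "g j = s (q ^ 2 - q + j)" unfolding g_def c(2) using ge j q1 by auto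
    finally have "(\<Sum>i=j..q - 1. c_coeff q (q ^ 2 + i)) = s (q ^ 2 - q + j)" by simp
    moreover have "q ^ 2 - q = (q - 1) * q" unfolding qq(1) by simp
    then have "of_nat (q ^ 2 - q + j) = (of_nat j :: 'a)" by (simp only:) (simp add: q0)
    ultimately show ?thesis unfolding S by simp
  qed
  show ?thesis using i ii iii iv v unfolding S_def by blast
qed

end
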